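(* Let $A_1,A_2\in\mathbf{C}^{n\times n}$, $B_1,B_2\in\mathbf{C}^{n\times m}$, and let $Q\in\mathbf{C}^{n\times n}$, $R\in\mathbf{C}^{m\times m}$ be positive definite (Hermitian). Assume that the complex-valued linear system $$x(k+1)=\{A_1,A_2\}x(k)+\{B_1,B_2\}u(k)$$ is stabilizable and that $\{P_1,P_2\}$ is the unique positive definite bimatrix solution of the bimatrix Riccati equation $$-\{Q,0\}=\{A_1,A_2\}^{\mathrm H}\{P_1,P_2\}\{A_1,A_2\}-\{P_1,P_2\}-\{A_1,A_2\}^{\mathrm H}\{P_1,P_2\}\{B_1,B_2\}\{S_1,S_2\}^{-1}\{B_1,B_2\}^{\mathrm H}\{P_1,P_2\}\{A_1,A_2\},$$ where $\{S_1,S_2\}=\{R,0\}+\{B_1,B_2\}^{\mathrm H}\{P_1,P_2\}\{B_1,B_2\}$. Define the sequence of bimatrices $\{P_1(k),P_2(k)\}$, $k\ge 0$, by $\{P_1(0),P_2(0)\}=\{Q,0\}$ and $$\begin{aligned}\{P_1(k+1),P_2(k+1)\}={}&\{Q,0\}+\{A_1,A_2\}^{\mathrm H}\{P_1(k),P_2(k)\}\{A_1,A_2\}\\&-\{A_1,A_2\}^{\mathrm H}\{P_1(k),P_2(k)\}\{B_1,B_2\}\{S_1(k),S_2(k)\}^{-1}\{B_1,B_2\}^{\mathrm H}\{P_1(k),P_2(k)\}\{A_1,A_2\},\end{aligned}$$ where $\{S_1(k),S_2(k)\}=\{R,0\}+\{B_1,B_2\}^{\mathrm H}\{P_1(k),P_2(k)\}\{B_1,B_2\}$.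 Then, for every $k\ge 0$, $$\{Q,0\}\le\{P_1(k),P_2(k)\}\le\{P_1(k+1),P_2(k+1)\}\le\{P_1,P_2\}.$$ Consequently, the limit of $\{P_1(k),P_2(k)\}$ as $k\to\infty$ exists and $$\{P_1,P_2\}=\lim_{k\to\infty}\{P_1(k),P_2(k)\}.$$
   Context: For a complex matrix $M$, $M^{\#}$, $M^{\mathrm T}$, $M^{\mathrm H}$ denote its (entrywise) conjugate, transpose and conjugate transpose. Positive definite matrices are Hermitian. Bimatrices. For $M_1,M_2\in\mathbf{C}^{p\times q}$ the bimatrix $\{M_1,M_2\}$ is the real-linear map $\mathbf{C}^q\to\mathbf{C}^p$, $\{M_1,M_2\}x=M_1x+M_2^{\#}x^{\#}$. Addition is componentwise. The product is composition: $\{M_1,M_2\}\{N_1,N_2\}=\{M_1N_1+M_2^{\#}N_2,\;M_2N_1+M_1^{\#}N_2\}$. The identity is $\{I,0\}$, and the inverse $\{M_1,M_2\}^{-1}$ is the bimatrix whose products with $\{M_1,M_2\}$ equal $\{I,0\}$. The conjugate transpose is $\{M_1,M_2\}^{\mathrm H}=\{M_1^{\mathrm H},M_2^{\mathrm T}\}$ (the adjoint with respect to the real inner product $\operatorname{Re}(x^{\mathrm H}y)$). A bimatrix $\{P_1,P_2\}$ with $P_i\in\mathbf{C}^{n\times n}$ is positive definite, written $\{P_1,P_2\}>0$, if $\{P_1,P_2\}^{\mathrm H}=\{P_1,P_2\}$ and $\operatorname{Re}(x^{\mathrm H}\{P_1,P_2\}x)>0$ for all nonzero $x\in\mathbf{C}^n$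 (equivalently, the $2n\times 2n$ matrix $\begin{bmatrix}P_1&P_2^{\#}\\P_2&P_1^{\#}\end{bmatrix}$ is positive definite); positive semidefinite ($\ge 0$) is defined with $\ge$ in place of $>$. For self-adjoint bimatrices, $\{M_1,M_2\}\le\{N_1,N_2\}$ means $\{N_1-M_1,N_2-M_2\}\ge 0$. Limits of bimatrices are taken componentwise. Stabilizability. The system $x(k+1)=\{A_1,A_2\}x(k)+\{B_1,B_2\}u(k)$, with state $x(k)\in\mathbf{C}^n$ and control $u(k)\in\mathbf{C}^m$, is stabilizable if there exist $K_1,K_2\in\mathbf{C}^{m\times n}$ such that, with $u(k)=\{K_1,K_2\}x(k)=K_1x(k)+K_2^{\#}x^{\#}(k)$, the closed-loop system $x(k+1)=(\{A_1,A_2\}+\{B_1,B_2\}\{K_1,K_2\})x(k)$ is asymptotically stable. *)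

theory Defs
  imports "HOL-Analysis.Analysis"
begin

definition vec_cnj :: "complex^'n \<Rightarrow> complex^'n"
  where "vec_cnj x = (\<chi> i. cnj (x $ i))"

definition mat_cnj :: "complex^'q^'p \<Rightarrow> complex^'q^'p"
  where "mat_cnj M = (\<chi> i j. cnj (M $ i $ j))"

definition ctranspose :: "complex^'q^'p \<Rightarrow> complex^'p^'q"
  where "ctranspose M = transpose (mat_cnj M)"

text \<open>The scalar \<open>x\<^sup>H y\<close>.\<close>

definition cdot :: "complex^'n \<Rightarrow> complex^'n \<Rightarrow> complex"
  where "cdot x y = (\<Sum>i\<in>UNIV. cnj (x $ i) * y $ i)"

text \<open>For Hermitian \<open>M\<close> the number \<open>x\<^sup>H M x\<close> is real, so taking its real part
  loses nothing.\<close>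

definition pos_def_matrix :: "complex^'n^'n \<Rightarrow> bool"
  where "pos_def_matrix M \<longleftrightarrow>
    ctranspose M = M \<and> (\<forall>x. x \<noteq> 0 \<longrightarrow> Re (cdot x (M *v x)) > 0)"

text \<open>A bimatrix is represented by the pair of its two matrices; the real-linear map it denotes
  is \<open>bim_apply\<close>, and \<open>bim_apply_inject\<close> shows that the pair is determined by the map.
  Addition, subtraction and limits are those of the product type, hence componentwise.\<close>

type_synonym ('p, 'q) bimat = "(complex^'q^'p) \<times> (complex^'q^'p)"

definition bim_apply :: "('p::finite, 'q::finite) bimat \<Rightarrow> complex^'q \<Rightarrow> complex^'p"
  where "bim_apply M x = fst M *v x + mat_cnj (snd M) *v vec_cnj x"

definition bim_mult ::
    "('p::finite, 'q::finite) bimat \<Rightarrow> ('q, 'r::finite) bimat \<Rightarrow> ('p, 'r) bimat"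
    (infixl "\<odot>" 70)
  where "M \<odot> N =
    (fst M ** fst N + mat_cnj (snd M) ** snd N, snd M ** fst N + mat_cnj (fst M) ** snd N)"

definition bim_one :: "('n::finite, 'n) bimat"
  where "bim_one = (mat 1, 0)"

text \<open>Meaningful only for invertible \<open>M\<close>; see \<open>bim_inv_eqI\<close>.\<close>

definition bim_inv :: "('n::finite, 'n) bimat \<Rightarrow> ('n, 'n) bimat"
  where "bim_inv M = (THE N. M \<odot> N = bim_one \<and> N \<odot> M = bim_one)"

definition bim_adj :: "('p::finite, 'q::finite) bimat \<Rightarrow> ('q, 'p) bimat"
  where "bim_adj M = (ctranspose (fst M), transpose (snd M))"

definition bim_pos_def :: "('n::finite, 'n) bimat \<Rightarrow> bool"
  where "bim_pos_def P \<longleftrightarrow>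
    bim_adj P = P \<and> (\<forall>x. x \<noteq> 0 \<longrightarrow> Re (cdot x (bim_apply P x)) > 0)"

definition bim_pos_semidef :: "('n::finite, 'n) bimat \<Rightarrow> bool"
  where "bim_pos_semidef P \<longleftrightarrow>
    bim_adj P = P \<and> (\<forall>x. x \<noteq> 0 \<longrightarrow> Re (cdot x (bim_apply P x)) \<ge> 0)"

text \<open>Not the componentwise order on pairs.\<close>

definition bim_le :: "('n::finite, 'n) bimat \<Rightarrow> ('n, 'n) bimat \<Rightarrow> bool"  (infix "\<preceq>" 50)
  where "M \<preceq> N \<longleftrightarrow> bim_pos_semidef (N - M)"

lemma vec_cnj_add: "vec_cnj (x + y) = vec_cnj x + vec_cnj y"
  by (simp add: vec_cnj_def vec_eq_iff)

lemma vec_cnj_vec_cnj [simp]: "vec_cnj (vec_cnj x) = x"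
  by (simp add: vec_cnj_def vec_eq_iff)

lemma mat_cnj_mat_cnj [simp]: "mat_cnj (mat_cnj M) = M"
  by (simp add: mat_cnj_def vec_eq_iff)

lemma mat_cnj_add: "mat_cnj (M + N) = mat_cnj M + mat_cnj N"
  by (simp add: mat_cnj_def vec_eq_iff)

lemma mat_cnj_mult: "mat_cnj (M ** N) = mat_cnj M ** mat_cnj N"
  by (simp add: mat_cnj_def matrix_matrix_mult_def vec_eq_iff)

lemma vec_cnj_mult: "vec_cnj (M *v x) = mat_cnj M *v vec_cnj x"
  by (simp add: mat_cnj_def vec_cnj_def matrix_vector_mult_def vec_eq_iff)

lemma bim_apply_mult: "bim_apply (M \<odot> N) x = bim_apply M (bim_apply N x)"
  by (simp add: bim_apply_def bim_mult_def mat_cnj_add mat_cnj_mult vec_cnj_add vec_cnj_mult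
      matrix_vector_mult_add_rdistrib matrix_vector_right_distrib flip: matrix_vector_mul_assoc)

lemma mat_cnj_0 [simp]: "mat_cnj 0 = 0"
  by (simp add: mat_cnj_def vec_eq_iff)

lemma bim_apply_one: "bim_apply bim_one x = x"
  by (simp add: bim_apply_def bim_one_def)

lemma bim_apply_inject:
  fixes M N :: "('p::finite, 'q::finite) bimat"
  shows "bim_apply M = bim_apply N \<longleftrightarrow> M = N"
proof
  assume eq: "bim_apply M = bim_apply N"
  have col: "bim_apply L (axis j c) $ i = fst L $ i $ j * c + cnj (snd L $ i $ j) * cnj c"
    for L :: "('p, 'q) bimat" and i j c
  proof -
    have "vec_cnj (axis j c) = axis j (cnj c)"
      by (simp add: vec_cnj_def axis_def vec_eq_iff)
    then show ?thesis
      by (simp add: bim_apply_def mat_cnj_def matrix_vector_mult_def axis_def if_distrib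
          cong: if_cong)
  qed
  have "fst M $ i $ j = fst N $ i $ j \<and> snd M $ i $ j = snd N $ i $ j" for i j
  proof -
    have "fst M $ i $ j + cnj (snd M $ i $ j) = fst N $ i $ j + cnj (snd N $ i $ j)"
      using col[of M j 1 i] col[of N j 1 i] eq by simp
    moreover have "fst M $ i $ j - cnj (snd M $ i $ j) = fst N $ i $ j - cnj (snd N $ i $ j)"
    proof -
      have "(fst M $ i $ j - cnj (snd M $ i $ j)) * \<i> = (fst N $ i $ j - cnj (snd N $ i $ j)) * \<i>"
        using col[of M j \<i> i] col[of N j \<i> i] eq by (simp add: algebra_simps)
      then show ?thesis by simp
    qed
    ultimately show ?thesis by (auto simp: complex_eq_iff)
  qed
  then show "M = N" by (simp add: prod_eq_iff vec_eq_iff)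
qed simp

lemma bim_inv_eqI:
  assumes "M \<odot> N = bim_one" and "N \<odot> M = bim_one"
  shows "bim_inv M = N"
  unfolding bim_inv_def
proof (rule the_equality)
  fix N' assume N': "M \<odot> N' = bim_one \<and> N' \<odot> M = bim_one"
  have "bim_apply N' x = bim_apply N x" for x
    by (metis N' assms bim_apply_mult bim_apply_one)
  then show "N' = N" by (simp flip: bim_apply_inject add: fun_eq_iff)
qed (use assms in simp)

lemma cdot_ctranspose: "cdot (ctranspose M *v x) y = cdot x (M *v y)"
proof -
  have "cdot (ctranspose M *v x) y = (\<Sum>i\<in>UNIV. \<Sum>j\<in>UNIV. cnj (x $ j) * M $ j $ i * y $ i)"
    by (simp add: cdot_def ctranspose_def mat_cnj_def transpose_def matrix_vector_mult_def
        sum_distrib_right sum_distrib_left mult_ac)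
  also have "\<dots> = (\<Sum>j\<in>UNIV. \<Sum>i\<in>UNIV. cnj (x $ j) * M $ j $ i * y $ i)"
    by (rule sum.swap)
  also have "\<dots> = cdot x (M *v y)"
    by (simp add: cdot_def matrix_vector_mult_def sum_distrib_left mult_ac)
  finally show ?thesis .
qed

lemma bim_adj_adjoint: "Re (cdot (bim_apply (bim_adj M) x) y) = Re (cdot x (bim_apply M y))"
proof -
  have add: "cdot (u + v) w = cdot u w + cdot v w" "cdot w (u + v) = cdot w u + cdot w v"
    for u v w :: "complex^'z"
    by (simp_all add: cdot_def algebra_simps sum.distrib)
  have cnj: "Re (cdot u v) = Re (cdot (vec_cnj u) (vec_cnj v))" for u v :: "complex^'z"
    by (simp add: cdot_def vec_cnj_def)
  have "mat_cnj (transpose (snd M)) = ctranspose (snd M)"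
    by (simp add: ctranspose_def mat_cnj_def transpose_def)
  then have "Re (cdot (mat_cnj (transpose (snd M)) *v vec_cnj x) y)
      = Re (cdot (vec_cnj x) (snd M *v y))"
    by (simp add: cdot_ctranspose)
  also have "\<dots> = Re (cdot x (mat_cnj (snd M) *v vec_cnj y))"
    by (subst cnj) (simp add: vec_cnj_mult)
  finally show ?thesis
    by (simp add: bim_apply_def bim_adj_def add cdot_ctranspose)
qed

definition trajectory :: "('a \<Rightarrow> 'a) \<Rightarrow> (nat \<Rightarrow> 'a) \<Rightarrow> bool"
  where "trajectory f x \<longleftrightarrow> (\<forall>k. x (Suc k) = f (x k))"

text \<open>Lyapunov stability and attractivity of the origin. Attractivity is required globally,
  which for homogeneous maps such as \<open>bim_apply M\<close> is the same as locally.\<close>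

definition asymptotically_stable :: "('a::real_normed_vector \<Rightarrow> 'a) \<Rightarrow> bool"
  where "asymptotically_stable f \<longleftrightarrow>
    (\<forall>\<epsilon>>0. \<exists>\<delta>>0. \<forall>x. trajectory f x \<and> norm (x 0) < \<delta> \<longrightarrow> (\<forall>k. norm (x k) < \<epsilon>)) \<and>
    (\<forall>x. trajectory f x \<longrightarrow> x \<longlonglongrightarrow> 0)"

definition bim_stabilizable :: "('n::finite, 'n) bimat \<Rightarrow> ('n, 'm::finite) bimat \<Rightarrow> bool"
  where "bim_stabilizable A B \<longleftrightarrow>
    (\<exists>K :: ('m, 'n) bimat. asymptotically_stable (bim_apply (A + B \<odot> K)))"

definition riccati_S ::
    "('n::finite, 'm::finite) bimat \<Rightarrow> complex^'m^'m \<Rightarrow> ('n, 'n) bimat \<Rightarrow> ('m, 'm) bimat"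
  where "riccati_S B R P = (R, 0) + bim_adj B \<odot> P \<odot> B"

definition riccati_eq ::
    "('n::finite, 'n) bimat \<Rightarrow> ('n, 'm::finite) bimat \<Rightarrow> complex^'n^'n \<Rightarrow> complex^'m^'m \<Rightarrow>
      ('n, 'n) bimat \<Rightarrow> bool"
  where "riccati_eq A B Q R P \<longleftrightarrow>
    - (Q, 0) = bim_adj A \<odot> P \<odot> A - P
      - bim_adj A \<odot> P \<odot> B \<odot> bim_inv (riccati_S B R P) \<odot> bim_adj B \<odot> P \<odot> A"

primrec riccati_iter ::
    "('n::finite, 'n) bimat \<Rightarrow> ('n, 'm::finite) bimat \<Rightarrow> complex^'n^'n \<Rightarrow> complex^'m^'m \<Rightarrow>
      nat \<Rightarrow> ('n, 'n) bimat"
  where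
    "riccati_iter A B Q R 0 = (Q, 0)"
  | "riccati_iter A B Q R (Suc k) =
      (let P = riccati_iter A B Q R k in
        (Q, 0) + bim_adj A \<odot> P \<odot> A
          - bim_adj A \<odot> P \<odot> B \<odot> bim_inv (riccati_S B R P) \<odot> bim_adj B \<odot> P \<odot> A)"

end

theory Submission
  imports Defs
begin

text \<open>With \<open>S = R + B\<^sup>H P B\<close>, completing the square shows that the Riccati map \<open>P \<mapsto> \<Phi>(P)\<close> satisfies
  \<open>\<langle>x, \<Phi>(P) x\<rangle> = min\<^sub>u \<langle>x, Q x\<rangle> + \<langle>u, R u\<rangle> + \<langle>A x + B u, P (A x + B u)\<rangle>\<close> for the real inner
  product, whenever \<open>P \<ge> 0\<close>. Hence \<open>\<Phi>\<close> is monotone and \<open>\<Phi>(P) \<ge> Q\<close>, so the iterates starting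
  from \<open>Q\<close> increase and stay below every positive definite fixed point. They therefore
  converge; since the inverses of the \<open>S(k)\<close> are uniformly bounded by the coercivity of \<open>R\<close>, the
  limit is a fixed point of \<open>\<Phi>\<close>, and it is positive definite because it dominates \<open>Q\<close>. Uniqueness
  identifies it with \<open>P\<close>.\<close>

section \<open>Bimatrices as real-linear maps\<close>

text \<open>Passes to the real inner product of the Euclidean space, where bimatrices are ordinary
  real-linear maps.\<close>

lemma Re_cdot: "Re (cdot x y) = x \<bullet> y"
  by (simp add: cdot_def inner_vec_def inner_complex_def)

lemma inner_bim_adj: "bim_apply (bim_adj M) x \<bullet> y = x \<bullet> bim_apply M y"
  using bim_adj_adjoint[of M x y] by (simp add: Re_cdot)

lemma mat_cnj_diff: "mat_cnj (M - N) = mat_cnj M - mat_cnj N"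
  by (simp add: mat_cnj_def vec_eq_iff)

lemma bim_apply_plus: "bim_apply (M + N) x = bim_apply M x + bim_apply N x"
  by (simp add: bim_apply_def mat_cnj_add matrix_vector_mult_add_rdistrib)

lemma bim_apply_minus: "bim_apply (M - N) x = bim_apply M x - bim_apply N x"
  by (simp add: bim_apply_def mat_cnj_diff matrix_vector_mult_diff_rdistrib)

lemma bim_apply_component:
  "bim_apply M x $ i = (\<Sum>j\<in>UNIV. fst M $ i $ j * x $ j + cnj (snd M $ i $ j * x $ j))"
  by (simp add: bim_apply_def matrix_vector_mult_def mat_cnj_def vec_cnj_def sum.distrib)

lemma linear_bim_apply: "linear (bim_apply M)"
  by (rule linearI)
    (simp_all add: vec_eq_iff bim_apply_component algebra_simps sum.distrib scaleR_sum_right)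

lemma bim_apply_add: "bim_apply M (x + y) = bim_apply M x + bim_apply M y"
  by (rule linear_add[OF linear_bim_apply])

lemma bim_apply_diff: "bim_apply M (x - y) = bim_apply M x - bim_apply M y"
  by (rule linear_diff[OF linear_bim_apply])

lemma bim_apply_axis:
  "bim_apply M (axis j c) $ i = fst M $ i $ j * c + cnj (snd M $ i $ j * c)"
proof -
  have "bim_apply M (axis j c) $ i =
      (\<Sum>k\<in>UNIV. if k = j then fst M $ i $ j * c + cnj (snd M $ i $ j * c) else 0)"
    unfolding bim_apply_component by (rule sum.cong) (auto simp: axis_def)
  then show ?thesis by simp
qed

text \<open>For entries \<open>a\<close> and \<open>b\<close> of the pair, the values at
  \<open>axis j 1\<close> and \<open>axis j \<i>\<close> are \<open>a + cnj b\<close> and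
  \<open>\<i> * (a - cnj b)\<close>. Solving for \<open>a\<close> expresses an entry through two
  values of the map.\<close>

lemma fst_bim_eq:
  "fst M $ i $ j = (bim_apply M (axis j 1) $ i - \<i> * bim_apply M (axis j \<i>) $ i) / 2"
  by (simp add: bim_apply_axis algebra_simps)

lemma snd_bim_eq:
  "snd M $ i $ j = cnj ((bim_apply M (axis j 1) $ i + \<i> * bim_apply M (axis j \<i>) $ i) / 2)"
  by (simp add: bim_apply_axis algebra_simps)

text \<open>A real-linear map splits into a complex-linear and a conjugate-linear part. This turns
  inverses and pointwise limits of bimatrices into bimatrices again.\<close>

lemma linear_imp_bim_apply:
  fixes f :: "complex^'q \<Rightarrow> complex^'p"
  assumes "linear f"
  shows "\<exists>M. bim_apply M = f"
proof -
  \<comment> \<open>The entries are forced by \<open>fst_bim_eq\<close> and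
    \<open>snd_bim_eq\<close>; agreement on the real basis then suffices.\<close>
  define M :: "('p, 'q) bimat" where
    "M = (\<chi> i j. (f (axis j 1) $ i - \<i> * f (axis j \<i>) $ i) / 2,
      \<chi> i j. cnj ((f (axis j 1) $ i + \<i> * f (axis j \<i>) $ i) / 2))"
  have ax: "bim_apply M (axis j 1) = f (axis j 1)" "bim_apply M (axis j \<i>) = f (axis j \<i>)" for j
    by (simp_all add: vec_eq_iff bim_apply_axis M_def field_simps)
  have "bim_apply M x = f x" for x
  proof (rule linear_eq_on[OF linear_bim_apply assms])
    show "x \<in> span Basis" by (simp add: span_Basis)
    show "bim_apply M b = f b" if "b \<in> Basis" for b
      using that ax by (auto simp: Basis_vec_def Basis_complex_def)
  qed
  then show ?thesis by blast
qed

lemma bim_eqI: "(\<And>x. bim_apply M x = bim_apply N x) \<Longrightarrow> M = N"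
  by (simp flip: bim_apply_inject add: fun_eq_iff)

lemma bim_self_adjoint_iff:
  "bim_adj M = M \<longleftrightarrow> (\<forall>x y. bim_apply M x \<bullet> y = x \<bullet> bim_apply M y)"
proof
  assume sym: "\<forall>x y. bim_apply M x \<bullet> y = x \<bullet> bim_apply M y"
  show "bim_adj M = M"
    by (rule bim_eqI, rule vector_eq_rdot[THEN iffD1]) (simp add: inner_bim_adj sym)
qed (metis inner_bim_adj)

lemma bim_adjD: "bim_adj M = M \<Longrightarrow> bim_apply M x \<bullet> y = x \<bullet> bim_apply M y"
  by (simp add: bim_self_adjoint_iff)

lemma bim_pos_semidef_iff:
  "bim_pos_semidef M \<longleftrightarrow> bim_adj M = M \<and> (\<forall>x. 0 \<le> x \<bullet> bim_apply M x)"
  unfolding bim_pos_semidef_def Re_cdot by (metis inner_zero_left order_refl)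

lemma bim_pos_def_iff:
  "bim_pos_def M \<longleftrightarrow> bim_adj M = M \<and> (\<forall>x. x \<noteq> 0 \<longrightarrow> 0 < x \<bullet> bim_apply M x)"
  unfolding bim_pos_def_def Re_cdot ..

lemma bim_pos_def_imp_semidef: "bim_pos_def M \<Longrightarrow> bim_pos_semidef M"
  unfolding bim_pos_def_def bim_pos_semidef_def by (meson less_imp_le)

text \<open>Allows all estimates to be made on quadratic forms and converted to
  \<open>\<preceq>\<close> only at the end.\<close>

lemma bim_le_iff:
  assumes "bim_adj M = M" and "bim_adj N = N"
  shows "M \<preceq> N \<longleftrightarrow> (\<forall>x. x \<bullet> bim_apply M x \<le> x \<bullet> bim_apply N x)"
  unfolding bim_le_def bim_pos_semidef_iff bim_self_adjoint_iff
  by (simp add: bim_apply_minus inner_diff_left inner_diff_right bim_adjD assms)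

lemma bim_pos_def_of_matrix: "pos_def_matrix M \<Longrightarrow> bim_pos_def (M, 0)"
  by (simp add: pos_def_matrix_def bim_pos_def_def bim_adj_def bim_apply_def transpose_def
      vec_eq_iff)

text \<open>The quadratic form attains a positive minimum on the compact unit sphere; homogeneity of
  degree two extends the bound to all vectors.\<close>

lemma bim_pos_def_coercive:
  fixes M :: "('n::finite, 'n) bimat"
  assumes "bim_pos_def M"
  obtains r where "r > 0" and "\<And>x. r * (norm x)\<^sup>2 \<le> x \<bullet> bim_apply M x"
proof -
  let ?q = "\<lambda>x. x \<bullet> bim_apply M x"
  have "continuous_on (sphere 0 1) ?q"
    by (intro continuous_intros linear_continuous_on linear_conv_bounded_linear[THEN iffD1] linear_bim_apply)
  \<comment> \<open>Any unit vector will do: the sphere must be nonempty for the minimum to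
    exist.\<close>
  moreover have "axis undefined 1 \<in> sphere (0 :: complex^'n) 1"
    by simp
  ultimately obtain z where z: "z \<in> sphere 0 1" "\<And>y. y \<in> sphere 0 1 \<Longrightarrow> ?q z \<le> ?q y"
    using continuous_attains_inf[OF compact_sphere, of 0 1 ?q] by blast
  have "z \<noteq> 0" using z(1) by auto
  then have pos: "?q z > 0" using assms by (simp add: bim_pos_def_iff)
  have "?q z * (norm x)\<^sup>2 \<le> ?q x" for x
  proof (cases "x = 0")
    case False
    define y where "y = x /\<^sub>R norm x"
    have x: "x = norm x *\<^sub>R y" using False by (simp add: y_def)
    have "?q (c *\<^sub>R y) = c\<^sup>2 * ?q y" for c
      by (simp add: linear_scale[OF linear_bim_apply] power2_eq_square)
    from this[of "norm x"] have "?q x = (norm x)\<^sup>2 * ?q y" by (simp flip: x)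
    moreover have "?q z \<le> ?q y" using False by (intro z(2)) (simp add: y_def)
    ultimately show ?thesis by (simp add: mult.commute mult_right_mono)
  qed simp
  with pos show thesis using that by blast
qed

section \<open>Inverses\<close>

text \<open>Definiteness gives injectivity, hence in finite dimension a linear two-sided inverse.
  Being real-linear it is a bimatrix, so the description defining \<open>bim_inv\<close> is
  met.\<close>

lemma bim_inv_pos_def:
  assumes "bim_pos_def S"
  shows "bim_apply S (bim_apply (bim_inv S) x) = x" and "bim_apply (bim_inv S) (bim_apply S x) = x"
proof -
  have "inj (bim_apply S)"
    unfolding linear_injective_0[OF linear_bim_apply]
    using assms unfolding bim_pos_def_iff by (metis inner_zero_right less_irrefl)
  then obtain g where g: "linear g" "\<And>x. g (bim_apply S x) = x" "\<And>x. bim_apply S (g x) = x"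
    using linear_injective_isomorphism[OF linear_bim_apply] by metis
  from linear_imp_bim_apply[OF g(1)] obtain N where N: "bim_apply N = g" by blast
  have "bim_inv S = N"
    by (rule bim_inv_eqI; rule bim_eqI) (simp_all add: bim_apply_mult bim_apply_one N g)
  then show "bim_apply S (bim_apply (bim_inv S) x) = x" "bim_apply (bim_inv S) (bim_apply S x) = x"
    by (simp_all add: N g)
qed

section \<open>The Riccati map as a minimum\<close>

text \<open>One step of the recursion as a function of \<open>P\<close>, so that the Riccati
  equation becomes a fixed point equation.\<close>

definition riccati_map ::
    "('n::finite, 'n) bimat \<Rightarrow> ('n, 'm::finite) bimat \<Rightarrow> complex^'n^'n \<Rightarrow> complex^'m^'m \<Rightarrow>
      ('n, 'n) bimat \<Rightarrow> ('n, 'n) bimat"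
  where "riccati_map A B Q R P = (Q, 0) + bim_adj A \<odot> P \<odot> A
    - bim_adj A \<odot> P \<odot> B \<odot> bim_inv (riccati_S B R P) \<odot> bim_adj B \<odot> P \<odot> A"

lemma riccati_iter_Suc:
  "riccati_iter A B Q R (Suc k) = riccati_map A B Q R (riccati_iter A B Q R k)"
  by (simp add: riccati_map_def Let_def)

lemma riccati_eq_iff: fixes A :: "('a::finite, 'a) bimat"
  shows "riccati_eq A B Q R P \<longleftrightarrow> riccati_map A B Q R P = P"
proof -
  have "- q = a - p - g \<longleftrightarrow> q + a - g = p" for q a p g :: "('a, 'a) bimat"
    unfolding neg_eq_iff_add_eq_0 by (subst eq_iff_diff_eq_0[of _ p]) (simp add: algebra_simps)
  then show ?thesis unfolding riccati_eq_def riccati_map_def .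
qed

lemma riccati_map_apply:
  "bim_apply (riccati_map A B Q R P) x =
    bim_apply (Q, 0) x + bim_apply (bim_adj A) (bim_apply P (bim_apply A x))
    - bim_apply (bim_adj A) (bim_apply P (bim_apply B (bim_apply (bim_inv (riccati_S B R P))
        (bim_apply (bim_adj B) (bim_apply P (bim_apply A x))))))"
  by (simp add: riccati_map_def bim_apply_plus bim_apply_minus bim_apply_mult)

lemma riccati_S_apply:
  "bim_apply (riccati_S B R P) u =
    bim_apply (R, 0) u + bim_apply (bim_adj B) (bim_apply P (bim_apply B u))"
  by (simp add: riccati_S_def bim_apply_plus bim_apply_mult)

lemma inner_adj_right: "x \<bullet> bim_apply (bim_adj M) y = bim_apply M x \<bullet> y"
  by (metis inner_bim_adj inner_commute)

text \<open>The one-step linear-quadratic cost of control \<open>u\<close> at state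
  \<open>x\<close>, with terminal cost given by \<open>P\<close> at the successor state.\<close>

definition stage_cost ::
    "('n::finite, 'n) bimat \<Rightarrow> ('n, 'm::finite) bimat \<Rightarrow> complex^'n^'n \<Rightarrow> complex^'m^'m \<Rightarrow>
      ('n, 'n) bimat \<Rightarrow> complex^'n \<Rightarrow> complex^'m \<Rightarrow> real"
  where "stage_cost A B Q R P x u = x \<bullet> bim_apply (Q, 0) x + u \<bullet> bim_apply (R, 0) u
    + (bim_apply A x + bim_apply B u) \<bullet> bim_apply P (bim_apply A x + bim_apply B u)"

lemma stage_cost_mono:
  assumes "\<And>x. x \<bullet> bim_apply P x \<le> x \<bullet> bim_apply P' x"
  shows "stage_cost A B Q R P x u \<le> stage_cost A B Q R P' x u"
  unfolding stage_cost_def using assms by simp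

text \<open>The added term is the form of \<open>P\<close> at \<open>B u\<close>. The lower bound
  does not depend on \<open>P\<close>, which later bounds all inverses uniformly.\<close>

lemma riccati_S_ge:
  assumes "bim_pos_semidef P"
  shows "u \<bullet> bim_apply (R, 0) u \<le> u \<bullet> bim_apply (riccati_S B R P) u"
  using assms by (simp add: bim_pos_semidef_iff riccati_S_apply inner_add_right inner_adj_right)

lemma riccati_S_pos_def:
  assumes R: "pos_def_matrix R" and P: "bim_pos_semidef P"
  shows "bim_pos_def (riccati_S B R P)"
proof -
  have sa: "bim_adj P = P" and sR: "bim_adj (R, 0) = (R, 0)"
    using P bim_pos_def_of_matrix[OF R] by (simp_all add: bim_pos_semidef_iff bim_pos_def_iff)
  have "bim_adj (riccati_S B R P) = riccati_S B R P"
    by (simp add: bim_self_adjoint_iff riccati_S_apply inner_add_left inner_add_right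
        inner_bim_adj inner_adj_right bim_adjD[OF sa] bim_adjD[OF sR])
  moreover have "0 < u \<bullet> bim_apply (riccati_S B R P) u" if "u \<noteq> 0" for u
    using riccati_S_ge[OF P, of u] bim_pos_def_of_matrix[OF R] that
    unfolding bim_pos_def_iff by (meson less_le_trans)
  ultimately show ?thesis by (simp add: bim_pos_def_iff)
qed

context
  fixes A :: "('n::finite, 'n) bimat" and B :: "('n, 'm::finite) bimat"
    and Q :: "complex^'n^'n" and R :: "complex^'m^'m"
  assumes Q: "pos_def_matrix Q" and R: "pos_def_matrix R"
begin

lemma riccati_map_self_adjoint:
  assumes "bim_pos_semidef P"
  shows "bim_adj (riccati_map A B Q R P) = riccati_map A B Q R P"
proof -
  let ?S = "riccati_S B R P"
  have sa: "bim_adj P = P" and sQ: "bim_adj (Q, 0) = (Q, 0)"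
    using assms bim_pos_def_of_matrix[OF Q] by (simp_all add: bim_pos_semidef_iff bim_pos_def_iff)
  have S: "bim_pos_def ?S" by (rule riccati_S_pos_def[OF R assms])
  \<comment> \<open>Writing \<open>u\<close> and \<open>v\<close> as \<open>?S\<close> applied to
    their preimages transfers symmetry from \<open>?S\<close> to its inverse.\<close>
  have sS: "bim_apply (bim_inv ?S) u \<bullet> v = u \<bullet> bim_apply (bim_inv ?S) v" for u v
    using S by (metis bim_adjD bim_inv_pos_def(1) bim_pos_def_iff)
  \<comment> \<open>\<open>W\<close> is B^H P A, so the subtracted term has the symmetric shape W^H
    S^-1 W.\<close>
  define W where "W x = bim_apply (bim_adj B) (bim_apply P (bim_apply A x))" for x
  have cross: "bim_apply (bim_adj A) (bim_apply P (bim_apply B z)) \<bullet> y = z \<bullet> W y"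
    "y \<bullet> bim_apply (bim_adj A) (bim_apply P (bim_apply B z)) = W y \<bullet> z" for y z
    unfolding W_def inner_adj_right inner_bim_adj by (simp_all add: bim_adjD[OF sa])
  have quad: "bim_apply (bim_adj A) (bim_apply P (bim_apply A x)) \<bullet> y =
      x \<bullet> bim_apply (bim_adj A) (bim_apply P (bim_apply A y))" for x y
    unfolding inner_adj_right inner_bim_adj by (simp add: bim_adjD[OF sa])
  show ?thesis
    unfolding bim_self_adjoint_iff riccati_map_apply W_def[symmetric]
    by (simp add: inner_add_left inner_add_right inner_diff_left inner_diff_right
        cross quad sS bim_adjD[OF sQ])
qed

text \<open>Completion of the square, with \<open>- v\<close> the optimal control: as
  \<open>S\<close> maps \<open>v\<close> to B^H P A x, the terms linear in \<open>u\<close> are the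
  cross terms of the square, and its constant term is what the Riccati map subtracts.\<close>

lemma stage_cost_eq:
  fixes x :: "complex^'n"
  assumes "bim_pos_semidef P"
  defines "S \<equiv> riccati_S B R P"
  defines "v \<equiv> bim_apply (bim_inv S) (bim_apply (bim_adj B) (bim_apply P (bim_apply A x)))"
  shows "stage_cost A B Q R P x u =
    x \<bullet> bim_apply (riccati_map A B Q R P) x + (u + v) \<bullet> bim_apply S (u + v)"
proof -
  define w where "w = bim_apply (bim_adj B) (bim_apply P (bim_apply A x))"
  have sa: "bim_adj P = P" using assms by (simp add: bim_pos_semidef_iff)
  have S: "bim_pos_def S" unfolding S_def by (rule riccati_S_pos_def[OF R assms(1)])
  have Sv: "bim_apply S v = w" unfolding v_def w_def by (rule bim_inv_pos_def(1)[OF S])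
  have Bw: "bim_apply B z \<bullet> bim_apply P (bim_apply A x) = z \<bullet> w"
    "bim_apply A x \<bullet> bim_apply P (bim_apply B z) = z \<bullet> w" for z
    by (simp_all add: w_def inner_adj_right)
      (metis bim_adjD[OF sa] inner_commute)
  have "v \<bullet> bim_apply S u = u \<bullet> w"
    using S Sv by (metis bim_adjD bim_pos_def_iff inner_commute)
  then have "(u + v) \<bullet> bim_apply S (u + v) = u \<bullet> bim_apply S u + 2 * (u \<bullet> w) + v \<bullet> w"
    by (simp add: bim_apply_add inner_add_left inner_add_right Sv)
  moreover have "u \<bullet> bim_apply S u =
      u \<bullet> bim_apply (R, 0) u + bim_apply B u \<bullet> bim_apply P (bim_apply B u)"
    by (simp add: S_def riccati_S_apply inner_add_right inner_adj_right)
  moreover have "x \<bullet> bim_apply (riccati_map A B Q R P) x =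
      x \<bullet> bim_apply (Q, 0) x + bim_apply A x \<bullet> bim_apply P (bim_apply A x) - v \<bullet> w"
    by (simp add: riccati_map_apply inner_add_right inner_diff_right inner_adj_right Bw
        flip: v_def[unfolded S_def])
  ultimately show ?thesis
    by (simp add: stage_cost_def bim_apply_add inner_add_left inner_add_right Bw)
qed

lemma riccati_map_le_stage_cost:
  assumes "bim_pos_semidef P"
  shows "x \<bullet> bim_apply (riccati_map A B Q R P) x \<le> stage_cost A B Q R P x u"
  using stage_cost_eq[OF assms, of x u] bim_pos_def_imp_semidef[OF riccati_S_pos_def[OF R assms]]
  by (simp add: bim_pos_semidef_iff)

text \<open>The control \<open>- v\<close> makes the square in \<open>stage_cost_eq\<close>
  vanish.\<close>

lemma riccati_map_attained:
  assumes "bim_pos_semidef P"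
  shows "\<exists>u. x \<bullet> bim_apply (riccati_map A B Q R P) x = stage_cost A B Q R P x u"
  by (rule exI[of _ "- bim_apply (bim_inv (riccati_S B R P))
      (bim_apply (bim_adj B) (bim_apply P (bim_apply A x)))"])
    (simp add: stage_cost_eq[OF assms])

text \<open>The value is the cost of some control, whose control and terminal terms are
  nonnegative.\<close>

lemma riccati_map_ge:
  assumes "bim_pos_semidef P"
  shows "x \<bullet> bim_apply (Q, 0) x \<le> x \<bullet> bim_apply (riccati_map A B Q R P) x"
proof -
  obtain u where "x \<bullet> bim_apply (riccati_map A B Q R P) x = stage_cost A B Q R P x u"
    using riccati_map_attained[OF assms] by blast
  moreover have "0 \<le> u \<bullet> bim_apply (R, 0) u"
    using bim_pos_def_imp_semidef[OF bim_pos_def_of_matrix[OF R]] by (simp add: bim_pos_semidef_iff)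
  ultimately show ?thesis
    using assms by (simp add: stage_cost_def bim_pos_semidef_iff)
qed

text \<open>The optimal control for \<open>P'\<close> is a competitor for \<open>P\<close>, where it
  costs no more.\<close>

lemma riccati_map_mono:
  assumes "bim_pos_semidef P" and "bim_pos_semidef P'"
    and "\<And>x. x \<bullet> bim_apply P x \<le> x \<bullet> bim_apply P' x"
  shows "x \<bullet> bim_apply (riccati_map A B Q R P) x \<le> x \<bullet> bim_apply (riccati_map A B Q R P') x"
proof -
  obtain u where u: "x \<bullet> bim_apply (riccati_map A B Q R P') x = stage_cost A B Q R P' x u"
    using riccati_map_attained[OF assms(2)] by blast
  have "x \<bullet> bim_apply (riccati_map A B Q R P) x \<le> stage_cost A B Q R P x u"
    by (rule riccati_map_le_stage_cost[OF assms(1)])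
  also have "\<dots> \<le> stage_cost A B Q R P' x u" by (rule stage_cost_mono[OF assms(3)])
  finally show ?thesis unfolding u .
qed

lemma riccati_map_pos_def:
  assumes "bim_pos_semidef P"
  shows "bim_pos_def (riccati_map A B Q R P)"
  unfolding bim_pos_def_iff
  using riccati_map_self_adjoint[OF assms] riccati_map_ge[OF assms] bim_pos_def_of_matrix[OF Q]
  by (meson bim_pos_def_iff less_le_trans)

section \<open>Monotonicity and boundedness of the Riccati iterates\<close>

lemma riccati_iter_pos_def: "bim_pos_def (riccati_iter A B Q R k)"
proof (induction k)
  case 0
  then show ?case by (simp add: bim_pos_def_of_matrix[OF Q])
next
  case (Suc k)
  then show ?case
    unfolding riccati_iter_Suc by (intro riccati_map_pos_def bim_pos_def_imp_semidef)
qed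

lemmas riccati_iter_semidef = bim_pos_def_imp_semidef[OF riccati_iter_pos_def]

lemma riccati_iter_ge: "x \<bullet> bim_apply (Q, 0) x \<le> x \<bullet> bim_apply (riccati_iter A B Q R k) x"
proof (cases k)
  case (Suc j)
  then show ?thesis
    unfolding Suc riccati_iter_Suc by (intro riccati_map_ge riccati_iter_semidef)
qed simp

text \<open>The first step goes up because the Riccati map dominates \<open>Q\<close>; its
  monotonicity propagates this to all later steps.\<close>

lemma riccati_iter_incseq:
  "x \<bullet> bim_apply (riccati_iter A B Q R k) x \<le> x \<bullet> bim_apply (riccati_iter A B Q R (Suc k)) x"
proof (induction k arbitrary: x)
  case 0
  show ?case using riccati_iter_ge[of x "Suc 0"] by simp
next
  case (Suc k)
  show ?case
    using riccati_map_mono[OF riccati_iter_semidef riccati_iter_semidef Suc]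
    by (simp only: riccati_iter_Suc)
qed

text \<open>A fixed point dominates \<open>Q\<close>, and applying the monotone map moves the
  iterate but leaves the fixed point in place.\<close>

lemma riccati_iter_le:
  assumes P: "bim_pos_def P" and fixpt: "riccati_map A B Q R P = P"
  shows "x \<bullet> bim_apply (riccati_iter A B Q R k) x \<le> x \<bullet> bim_apply P x"
proof (induction k arbitrary: x)
  case 0
  show ?case using riccati_map_ge[OF bim_pos_def_imp_semidef[OF P]] by (simp add: fixpt)
next
  case (Suc k)
  then show ?case
    using riccati_map_mono[OF riccati_iter_semidef bim_pos_def_imp_semidef[OF P], of k x]
    by (simp add: fixpt riccati_iter_Suc del: riccati_iter.simps)
qed

end

section \<open>Limits of bimatrices\<close>

lemma tendsto_bim_apply:
  assumes "M \<longlonglongrightarrow> L" and "y \<longlonglongrightarrow> z"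
  shows "(\<lambda>k. bim_apply (M k) (y k)) \<longlonglongrightarrow> bim_apply L z"
  by (rule vec_tendstoI) (unfold bim_apply_component, intro tendsto_intros assms)

text \<open>Pointwise convergence suffices because each entry depends on just two values of the
  map.\<close>

lemma tendsto_bimI:
  assumes "\<And>x. (\<lambda>k. bim_apply (M k) x) \<longlonglongrightarrow> bim_apply L x"
  shows "M \<longlonglongrightarrow> L"
proof -
  have "(\<lambda>k. fst (M k)) \<longlonglongrightarrow> fst L"
    by (intro vec_tendstoI, unfold fst_bim_eq) (intro tendsto_intros assms; simp)
  moreover have "(\<lambda>k. snd (M k)) \<longlonglongrightarrow> snd L"
    by (intro vec_tendstoI, unfold snd_bim_eq) (intro tendsto_intros assms; simp)
  ultimately have "(\<lambda>k. (fst (M k), snd (M k))) \<longlonglongrightarrow> (fst L, snd L)" by (rule tendsto_Pair)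
  then show ?thesis by simp
qed

text \<open>Bounded monotone quadratic forms converge; polarization passes to the bilinear forms,
  hence to coordinates. The pointwise limit is linear, hence a bimatrix.\<close>

lemma bim_convergent_if_monotone_bounded:
  fixes M :: "nat \<Rightarrow> ('n::finite, 'n) bimat"
  assumes sa: "\<And>k. bim_adj (M k) = M k"
    and mono: "\<And>k x. x \<bullet> bim_apply (M k) x \<le> x \<bullet> bim_apply (M (Suc k)) x"
    and bound: "\<And>k x. x \<bullet> bim_apply (M k) x \<le> x \<bullet> bim_apply P x"
  shows "convergent M"
proof -
  have quad: "convergent (\<lambda>k. x \<bullet> bim_apply (M k) x)" for x
  proof -
    have "incseq (\<lambda>k. x \<bullet> bim_apply (M k) x)"
      using mono by (intro incseq_SucI)
    then obtain l where "(\<lambda>k. x \<bullet> bim_apply (M k) x) \<longlonglongrightarrow> l"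
      using bound by (rule incseq_convergent[OF _ allI])
    then show ?thesis by (rule convergentI)
  qed
  have polar: "x \<bullet> bim_apply (M k) y =
      ((x + y) \<bullet> bim_apply (M k) (x + y) - (x - y) \<bullet> bim_apply (M k) (x - y)) / 4" for x y k
  proof -
    have "y \<bullet> bim_apply (M k) x = x \<bullet> bim_apply (M k) y"
      by (metis bim_adjD[OF sa] inner_commute)
    then show ?thesis
      by (simp add: bim_apply_add bim_apply_diff inner_add_left inner_add_right inner_diff_left
          inner_diff_right)
  qed
  have bil: "convergent (\<lambda>k. x \<bullet> bim_apply (M k) y)" for x y
    by (subst polar, unfold divide_inverse)
      (intro convergent_mult convergent_diff quad convergent_const)
  define f where "f y = (\<Sum>b\<in>Basis. lim (\<lambda>k. b \<bullet> bim_apply (M k) y) *\<^sub>R b)" for y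
  have lim: "(\<lambda>k. bim_apply (M k) y) \<longlonglongrightarrow> f y" for y
  proof -
    have "(\<lambda>k. \<Sum>b\<in>Basis. (b \<bullet> bim_apply (M k) y) *\<^sub>R b) \<longlonglongrightarrow> f y"
      unfolding f_def by (intro tendsto_intros bil[unfolded convergent_LIMSEQ_iff])
    then show ?thesis by (simp add: inner_commute[of _ "bim_apply _ _"] euclidean_representation)
  qed
  have "linear f"
  proof (rule linearI)
    show "f (x + y) = f x + f y" for x y
      using lim[of "x + y"] tendsto_add[OF lim[of x] lim[of y]] LIMSEQ_unique
      by (simp add: bim_apply_add) blast
    show "f (c *\<^sub>R x) = c *\<^sub>R f x" for c x
      using lim[of "c *\<^sub>R x"] tendsto_scaleR[OF tendsto_const lim[of x]] LIMSEQ_unique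
      by (simp add: linear_scale[OF linear_bim_apply]) blast
  qed
  then obtain L where "bim_apply L = f" using linear_imp_bim_apply by blast
  then have "M \<longlonglongrightarrow> L" by (intro tendsto_bimI) (simp add: lim)
  then show ?thesis by (rule convergentI)
qed

text \<open>With \<open>z\<close> the image of \<open>x\<close> under the inverse of
  \<open>T\<close>, the error is the inverse of \<open>S k\<close> applied to
  \<open>x - bim_apply (S k) z\<close>. This residual tends to zero and the inverses are bounded by
  \<open>1 / r\<close>.\<close>

lemma tendsto_bim_inv:
  fixes S :: "nat \<Rightarrow> ('n::finite, 'n) bimat"
  assumes S: "\<And>k. bim_pos_def (S k)" and T: "bim_pos_def T" and lim: "S \<longlonglongrightarrow> T"
    and r: "r > 0" "\<And>k x. r * (norm x)\<^sup>2 \<le> x \<bullet> bim_apply (S k) x"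
  shows "(\<lambda>k. bim_inv (S k)) \<longlonglongrightarrow> bim_inv T"
proof (rule tendsto_bimI)
  fix x
  let ?G = "\<lambda>k. bim_apply (bim_inv (S k))"
  define z where "z = bim_apply (bim_inv T) x"
  have Tz: "bim_apply T z = x" by (simp add: z_def bim_inv_pos_def[OF T])
  \<comment> \<open>Coercivity is applied at \<open>?G k y\<close>, followed by
    Cauchy-Schwarz.\<close>
  have bound: "norm (?G k y) \<le> norm y / r" for k y
  proof (cases "?G k y = 0")
    case False
    have "r * (norm (?G k y))\<^sup>2 \<le> ?G k y \<bullet> y"
      using r(2)[of "?G k y" k] by (simp add: bim_inv_pos_def[OF S])
    also have "\<dots> \<le> norm (?G k y) * norm y" by (rule norm_cauchy_schwarz)
    finally have "r * norm (?G k y) \<le> norm y"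
      using False by (simp add: power2_eq_square)
    then show ?thesis using r(1) by (simp add: field_simps)
  qed (use r in simp)
  have le: "norm (?G k x - z) \<le> norm (x - bim_apply (S k) z) / r" for k
    using bound[of k "x - bim_apply (S k) z"]
    by (simp add: bim_apply_diff bim_inv_pos_def[OF S])
  have "(\<lambda>k. bim_apply (S k) z) \<longlonglongrightarrow> x"
    using tendsto_bim_apply[OF lim tendsto_const, of z] unfolding Tz .
  from tendsto_diff[OF tendsto_const this, of x]
  have "(\<lambda>k. x - bim_apply (S k) z) \<longlonglongrightarrow> 0" by simp
  then have "(\<lambda>k. norm (x - bim_apply (S k) z) / r) \<longlonglongrightarrow> 0"
    by (intro tendsto_divide_zero tendsto_norm_zero)
  then have "(\<lambda>k. ?G k x - z) \<longlonglongrightarrow> 0"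
    by (rule Lim_null_comparison[OF always_eventually[OF allI[OF le]]])
  then show "(\<lambda>k. ?G k x) \<longlonglongrightarrow> bim_apply (bim_inv T) x"
    by (simp add: LIM_zero_iff z_def)
qed

text \<open>Only the inverse needs care: a coercivity constant of \<open>R\<close> serves for every
  \<open>riccati_S B R (M k)\<close>.\<close>

lemma tendsto_riccati_map:
  assumes R: "pos_def_matrix R"
    and M: "\<And>k. bim_pos_semidef (M k)" and L: "bim_pos_semidef L" and lim: "M \<longlonglongrightarrow> L"
  shows "(\<lambda>k. riccati_map A B Q R (M k)) \<longlonglongrightarrow> riccati_map A B Q R L"
proof -
  obtain r where r: "r > 0" "\<And>u. r * (norm u)\<^sup>2 \<le> u \<bullet> bim_apply (R, 0) u"
    using bim_pos_def_coercive[OF bim_pos_def_of_matrix[OF R]] by blast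
  have "(\<lambda>k. riccati_S B R (M k)) \<longlonglongrightarrow> riccati_S B R L"
    by (rule tendsto_bimI) (auto simp: riccati_S_apply intro!: tendsto_intros tendsto_bim_apply lim)
  then have "(\<lambda>k. bim_inv (riccati_S B R (M k))) \<longlonglongrightarrow> bim_inv (riccati_S B R L)"
    by (rule tendsto_bim_inv[OF riccati_S_pos_def[OF R M] riccati_S_pos_def[OF R L] _ r(1)])
      (rule order_trans[OF r(2) riccati_S_ge[OF M]])
  then show ?thesis
    by (intro tendsto_bimI)
      (auto simp: riccati_map_apply intro!: tendsto_intros tendsto_bim_apply lim)
qed

section \<open>Convergence of the iterates to the Riccati solution\<close>

theorem theorem1:
  fixes A1 A2 :: "complex^'n^'n" and B1 B2 :: "complex^'m^'n"
    and Q :: "complex^'n^'n" and R :: "complex^'m^'m"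
    and P1 P2 :: "complex^'n^'n"
  assumes "pos_def_matrix Q" and "pos_def_matrix R"
    and "bim_stabilizable (A1, A2) (B1, B2)"
    and "bim_pos_def (P1, P2)" and "riccati_eq (A1, A2) (B1, B2) Q R (P1, P2)"
    and "\<forall>P'. bim_pos_def P' \<and> riccati_eq (A1, A2) (B1, B2) Q R P' \<longrightarrow> P' = (P1, P2)"
  shows "(\<forall>k. (Q, 0) \<preceq> riccati_iter (A1, A2) (B1, B2) Q R k \<and>
              riccati_iter (A1, A2) (B1, B2) Q R k \<preceq> riccati_iter (A1, A2) (B1, B2) Q R (k + 1) \<and>
              riccati_iter (A1, A2) (B1, B2) Q R (k + 1) \<preceq> (P1, P2)) \<and>
         (\<lambda>k. riccati_iter (A1, A2) (B1, B2) Q R k) \<longlonglongrightarrow> (P1, P2)"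
proof -
  let ?A = "(A1, A2)" and ?B = "(B1, B2)" and ?P = "(P1, P2)"
  let ?M = "riccati_iter ?A ?B Q R"
  note Q = assms(1) and R = assms(2) and P = assms(4)
  have fixpt: "riccati_map ?A ?B Q R ?P = ?P"
    using assms(5) by (simp add: riccati_eq_iff)
  have pos: "bim_pos_def (?M k)" for k by (rule riccati_iter_pos_def[OF Q R])
  have sa: "bim_adj (?M k) = ?M k" "bim_adj (Q, 0) = (Q, 0)" "bim_adj ?P = ?P" for k
    using pos bim_pos_def_of_matrix[OF Q] P by (simp_all add: bim_pos_def_iff)
  have "convergent ?M"
    by (rule bim_convergent_if_monotone_bounded[where M = ?M, OF sa(1)
          riccati_iter_incseq[OF Q R] riccati_iter_le[OF Q R P fixpt]])
  then obtain L where L: "?M \<longlonglongrightarrow> L" unfolding convergent_def by blast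
  have saL: "bim_adj L = L"
    unfolding bim_self_adjoint_iff
  proof (intro allI)
    fix x y
    have "(\<lambda>k. bim_apply (?M k) x \<bullet> y) \<longlonglongrightarrow> bim_apply L x \<bullet> y"
      and "(\<lambda>k. x \<bullet> bim_apply (?M k) y) \<longlonglongrightarrow> x \<bullet> bim_apply L y"
      by (intro tendsto_intros tendsto_bim_apply L)+
    then show "bim_apply L x \<bullet> y = x \<bullet> bim_apply L y"
      by (simp add: bim_adjD[OF sa(1)] LIMSEQ_unique)
  qed
  \<comment> \<open>The bound by \<open>Q\<close> survives the limit, so \<open>L\<close> is
    positive definite as uniqueness demands.\<close>
  have "x \<bullet> bim_apply (Q, 0) x \<le> x \<bullet> bim_apply L x" for x
    by (rule Lim_bounded2[of "\<lambda>k. x \<bullet> bim_apply (?M k) x" _ 0])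
      (auto intro!: tendsto_intros tendsto_bim_apply L riccati_iter_ge[OF Q R])
  then have posL: "bim_pos_def L"
    using saL bim_pos_def_of_matrix[OF Q] unfolding bim_pos_def_iff by (meson less_le_trans)
  \<comment> \<open>The shifted sequence tends both to \<open>L\<close> and to its image under the
    Riccati map.\<close>
  have "(\<lambda>k. ?M (Suc k)) \<longlonglongrightarrow> riccati_map ?A ?B Q R L"
    unfolding riccati_iter_Suc
    by (intro tendsto_riccati_map R bim_pos_def_imp_semidef pos posL L)
  with LIMSEQ_Suc[OF L] have "riccati_map ?A ?B Q R L = L"
    using LIMSEQ_unique by blast
  then have "L = ?P" by (intro assms(6)[rule_format] conjI posL) (simp add: riccati_eq_iff)
  with L have "?M \<longlonglongrightarrow> ?P" by simp
  moreover have "(Q, 0) \<preceq> ?M k" "?M k \<preceq> ?M (k + 1)" "?M (k + 1) \<preceq> ?P" for k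
    using riccati_iter_ge[OF Q R] riccati_iter_incseq[OF Q R] riccati_iter_le[OF Q R P fixpt]
    by (simp_all add: bim_le_iff sa del: riccati_iter.simps)
  ultimately show ?thesis by blast
qed

end
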